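(* Let $K=\mathbb{R}$ or $K=\mathbb{C}$, $n\in\mathbb{Z}_{>0}$, and let $\varphi^{[n]}:\mathbb{R}^n\to K$ be an $n$-dimensional tensor product mother scaling function, with associated spaces $V_j$, $j\in\mathbb{Z}$. Then $$\overline{\bigcup_{j\in\mathbb{Z}}V_j}=C_u(\mathbb{R}^n,K),$$ the closure being taken in the supremum norm.
   Context: $C_u(\mathbb{R}^n,K)$ is the Banach space of bounded uniformly continuous functions $\mathbb{R}^n\to K$ with the supremum norm. $\varphi:\mathbb{R}\to K$ is a compactly supported interpolating mother scaling function: it is continuous and compactly supported, $\varphi(k)=\delta_{k,0}$ for all $k\in\mathbb{Z}$, and $\varphi(x)=\sum_{k\in\mathbb{Z}}\varphi(k/2)\varphi(2x-k)$ for all $x\in\mathbb{R}$. The $n$-dimensional tensor product mother scaling function generated by $\varphi$ is $\varphi^{[n]}(x)=\prod_{i=1}^n\varphi(x_i)$, $x\in\mathbb{R}^n$. For $j\in\mathbb{Z}$, $$V_j=\Bigl\{x\mapsto\sum_{k\in\mathbb{Z}^n}a_k\,\varphi^{[n]}(2^jx-k)\ :\ (a_k)_{k}\in\ell^\infty(\mathbb{Z}^n,K)\Bigr\}$$ (the sum is pointwise, with finitely many nonzero terms at each $x$), equipped with the supremum norm. *)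

theory Defs
  imports "HOL-Analysis.Analysis"
begin

text \<open>
  The scalar field is a type of class \<^class>\<open>real_normed_field\<close>; it is instantiated with
  \<^typ>\<open>real\<close> and \<^typ>\<open>complex\<close>. The sums over integers or integer vectors below have only
  finitely many nonzero terms when the mother function is compactly supported, so that
  \<^const>\<open>infsum\<close> is there just the finite sum of these terms.
\<close>

definition interpolating_mother_scaling :: "(real \<Rightarrow> 'k::real_normed_field) \<Rightarrow> bool" where
  "interpolating_mother_scaling \<phi> \<longleftrightarrow>
     continuous_on UNIV \<phi> \<and>
     compact (closure {x. \<phi> x \<noteq> 0}) \<and>
     (\<forall>k::int. \<phi> (of_int k) = (if k = 0 then 1 else 0)) \<and>
     (\<forall>x. \<phi> x = (\<Sum>\<^sub>\<infinity>k\<in>(UNIV::int set). \<phi> (of_int k / 2) * \<phi> (2 * x - of_int k)))"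

definition tensor_mother :: "(real \<Rightarrow> 'k::real_normed_field) \<Rightarrow> real ^ 'n \<Rightarrow> 'k" where
  "tensor_mother \<phi> x = (\<Prod>i\<in>UNIV. \<phi> (x $ i))"

definition int_vec :: "int ^ 'n \<Rightarrow> real ^ 'n" where
  "int_vec k = (\<chi> i. of_int (k $ i))"

definition scaling_series ::
    "(real ^ 'n \<Rightarrow> 'k::real_normed_field) \<Rightarrow> int \<Rightarrow> (int ^ 'n \<Rightarrow> 'k) \<Rightarrow> real ^ 'n \<Rightarrow> 'k" where
  "scaling_series \<Phi> j a x = (\<Sum>\<^sub>\<infinity>k\<in>UNIV. a k * \<Phi> (2 powi j *\<^sub>R x - int_vec k))"

text \<open>
  The spaces are sets of elements of the normed space of bounded continuous functions, whose
  norm is the supremum norm. Restricting \<open>f\<close> to this type in the definition of \<open>V\<close> loses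
  nothing: by lemma \<open>scaling_series_in_V\<close> below, every series with bounded coefficients
  is a bounded continuous function.
\<close>

definition V :: "(real ^ 'n \<Rightarrow> 'k::real_normed_field) \<Rightarrow> int \<Rightarrow> ((real ^ 'n) \<Rightarrow>\<^sub>C 'k) set" where
  "V \<Phi> j = {f. \<exists>a. bounded (range a) \<and> apply_bcontfun f = scaling_series \<Phi> j a}"

definition C\<^sub>u :: "((real ^ 'n) \<Rightarrow>\<^sub>C 'k::real_normed_field) set" where
  "C\<^sub>u = {f. uniformly_continuous_on UNIV (apply_bcontfun f)}"

lemma finite_int_box: "finite {m :: int ^ 'n. \<forall>i. \<bar>m $ i\<bar> \<le> N}"
proof (rule finite_subset)
  show "{m :: int ^ 'n. \<forall>i. \<bar>m $ i\<bar> \<le> N} \<subseteq> vec_lambda ` (PiE UNIV (\<lambda>_. {-N..N}))"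
  proof
    fix m :: "int ^ 'n" assume "m \<in> {m. \<forall>i. \<bar>m $ i\<bar> \<le> N}"
    then have "vec_nth m \<in> PiE UNIV (\<lambda>_. {-N..N})" by (auto simp: abs_le_iff minus_le_iff)
    then show "m \<in> vec_lambda ` (PiE UNIV (\<lambda>_. {-N..N}))"
      by (metis image_eqI vec_nth_inverse)
  qed
  show "finite (vec_lambda ` (PiE UNIV (\<lambda>_::'n. {-N..N})) :: (int ^ 'n) set)"
    by (intro finite_imageI finite_PiE) auto
qed

lemma tensor_mother_continuous:
  assumes "interpolating_mother_scaling \<phi>"
  shows "continuous_on UNIV (tensor_mother \<phi>)"
proof -
  have c: "continuous_on UNIV \<phi>" using assms unfolding interpolating_mother_scaling_def by blast
  show ?thesis
    unfolding tensor_mother_def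
    by (intro continuous_on_prod continuous_on_compose2[OF c] continuous_intros) auto
qed

lemma tensor_mother_support:
  assumes "interpolating_mother_scaling \<phi>"
  obtains R where "\<And>y i. tensor_mother \<phi> y \<noteq> 0 \<Longrightarrow> \<bar>y $ i\<bar> \<le> R"
proof -
  have "bounded {x. \<phi> x \<noteq> 0}"
    using assms bounded_subset[OF compact_imp_bounded closure_subset]
    unfolding interpolating_mother_scaling_def by blast
  then obtain R where R: "\<And>x. \<phi> x \<noteq> 0 \<Longrightarrow> \<bar>x\<bar> \<le> R"
    unfolding bounded_real by blast
  have "\<bar>y $ i\<bar> \<le> R" if "tensor_mother \<phi> y \<noteq> 0" for y i
    using that by (intro R) (auto simp: tensor_mother_def)
  then show thesis using that by blast
qed

lemma tensor_mother_bounded: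
  fixes \<phi> :: "real \<Rightarrow> 'k::real_normed_field"
  assumes "interpolating_mother_scaling \<phi>"
  obtains B where "\<And>y :: real ^ 'n. norm (tensor_mother \<phi> y) \<le> B" "B \<ge> 0"
proof -
  obtain R where R: "\<And>(y :: real ^ 'n) i. tensor_mother \<phi> y \<noteq> 0 \<Longrightarrow> \<bar>y $ i\<bar> \<le> R"
    using tensor_mother_support[OF assms] by blast
  let ?S = "cbox (\<chi> i. -R) (\<chi> i. R) :: (real ^ 'n) set"
  have "continuous_on ?S (tensor_mother \<phi>)"
    by (rule continuous_on_subset[OF tensor_mother_continuous[OF assms]]) simp
  then have "bounded (tensor_mother \<phi> ` ?S)"
    by (intro compact_imp_bounded compact_continuous_image compact_cbox)
  then obtain B where B: "\<And>y. y \<in> ?S \<Longrightarrow> norm (tensor_mother \<phi> y) \<le> B"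
    unfolding bounded_iff by blast
  have "norm (tensor_mother \<phi> y) \<le> max B 0" for y :: "real ^ 'n"
  proof (cases "tensor_mother \<phi> y = 0")
    case False
    have "y \<in> ?S"
      using R[OF False] by (auto simp: mem_box_cart abs_le_iff minus_le_iff)
    then show ?thesis using B by fastforce
  qed simp
  then show thesis using that by (meson max.cobounded2)
qed

lemma scaling_series_local_sum:
  fixes \<Phi> :: "real ^ 'n \<Rightarrow> 'k::real_normed_field" and p :: "int ^ 'n"
  assumes R: "\<And>y i. \<Phi> y \<noteq> 0 \<Longrightarrow> \<bar>y $ i\<bar> \<le> R"
    and y: "\<And>i. \<bar>2 powi j * y $ i - of_int (p $ i)\<bar> \<le> 2"
  shows "scaling_series \<Phi> j a y =
    (\<Sum>m | \<forall>i. \<bar>m $ i\<bar> \<le> \<lceil>R\<rceil> + 2. a (p + m) * \<Phi> (2 powi j *\<^sub>R y - int_vec (p + m)))"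
proof -
  let ?M = "{m :: int ^ 'n. \<forall>i. \<bar>m $ i\<bar> \<le> \<lceil>R\<rceil> + 2}"
  let ?g = "\<lambda>k. a k * \<Phi> (2 powi j *\<^sub>R y - int_vec k)"
  have supp: "k \<in> (+) p ` ?M" if "?g k \<noteq> 0" for k
  proof -
    have "\<Phi> (2 powi j *\<^sub>R y - int_vec k) \<noteq> 0" using that by auto
    then have *: "\<bar>2 powi j * y $ i - of_int (k $ i)\<bar> \<le> R" for i
      using R[of "2 powi j *\<^sub>R y - int_vec k" i] by (simp add: int_vec_def)
    have "\<bar>(k - p) $ i\<bar> \<le> \<lceil>R\<rceil> + 2" for i
    proof -
      have "\<bar>of_int ((k - p) $ i)\<bar> \<le> R + 2" using *[of i] y[of i] by simp
      also have "\<dots> \<le> of_int (\<lceil>R\<rceil> + 2)" by (simp add: le_of_int_ceiling)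
      finally show ?thesis by (metis of_int_abs of_int_le_iff)
    qed
    then show ?thesis by (intro image_eqI[of _ _ "k - p"]) auto
  qed
  have "scaling_series \<Phi> j a y = infsum ?g ((+) p ` ?M)"
    unfolding scaling_series_def by (rule infsum_cong_neutral) (use supp in auto)
  also have "\<dots> = sum ?g ((+) p ` ?M)"
    by (intro infsum_finite finite_imageI finite_int_box)
  also have "\<dots> = (\<Sum>m\<in>?M. ?g (p + m))"
    by (subst sum.reindex) auto
  finally show ?thesis .
qed

lemma scaling_series_in_V:
  fixes \<phi> :: "real \<Rightarrow> 'k::real_normed_field" and a :: "int ^ 'n \<Rightarrow> 'k"
  assumes \<phi>: "interpolating_mother_scaling \<phi>" and a: "bounded (range a)"
  shows "\<exists>f \<in> V (tensor_mother \<phi>) j. apply_bcontfun f = scaling_series (tensor_mother \<phi>) j a"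
proof -
  let ?\<Phi> = "tensor_mother \<phi> :: real ^ 'n \<Rightarrow> 'k"
  let ?f = "scaling_series ?\<Phi> j a"
  obtain R where R: "\<And>(y :: real ^ 'n) i. ?\<Phi> y \<noteq> 0 \<Longrightarrow> \<bar>y $ i\<bar> \<le> R"
    using tensor_mother_support[OF \<phi>] by blast
  obtain B where B: "\<And>y. norm (?\<Phi> y) \<le> B" "B \<ge> 0"
    using tensor_mother_bounded[OF \<phi>] by blast
  obtain A where A: "\<And>k. norm (a k) \<le> A"
    using a unfolding bounded_iff by auto
  let ?M = "{m :: int ^ 'n. \<forall>i. \<bar>m $ i\<bar> \<le> \<lceil>R\<rceil> + 2}"
  define p :: "real ^ 'n \<Rightarrow> int ^ 'n" where "p x = (\<chi> i. \<lfloor>2 powi j * x $ i\<rfloor>)" for x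
  have px: "\<bar>2 powi j * x $ i - of_int (p x $ i)\<bar> \<le> 1" for x i
    unfolding p_def by simp linarith
  have px2: "\<bar>2 powi j * x $ i - of_int (p x $ i)\<bar> \<le> 2" for x i
    using px[of x i] by linarith
  note loc = scaling_series_local_sum[of ?\<Phi> R, OF R]
  have "norm (?f x) \<le> of_nat (card ?M) * (A * B)" for x
  proof -
    have "?f x = (\<Sum>m\<in>?M. a (p x + m) * ?\<Phi> (2 powi j *\<^sub>R x - int_vec (p x + m)))"
      by (rule loc, assumption, rule px2)
    also have "norm \<dots> \<le> of_nat (card ?M) * (A * B)"
      using order_trans[OF norm_ge_zero A]
      by (intro sum_norm_bound) (simp add: norm_mult mult_mono A B)
    finally show ?thesis .
  qed
  then have bd: "bounded (range ?f)" unfolding bounded_iff by blast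
  have "isCont ?f x" for x
  proof -
    let ?h = "\<lambda>y. \<Sum>m\<in>?M. a (p x + m) * ?\<Phi> (2 powi j *\<^sub>R y - int_vec (p x + m))"
    have "continuous_on UNIV ?h"
      by (intro continuous_intros continuous_on_compose2[OF tensor_mother_continuous[OF \<phi>]]) auto
    then have h: "isCont ?h x" by (simp add: continuous_on_eq_continuous_at)
    have pos: "(2::real) powi j > 0" by simp
    have "?f y = ?h y" if "dist y x < 1 / 2 powi j" for y
    proof (rule loc)
      fix i
      have "\<bar>y $ i - x $ i\<bar> \<le> dist y x"
        using component_le_norm_cart[of "y - x" i] by (simp add: dist_norm)
      then have "\<bar>y $ i - x $ i\<bar> < 1 / 2 powi j" using that by simp
      then have "2 powi j * \<bar>y $ i - x $ i\<bar> < 1" using pos by (simp add: field_simps)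
      then have "\<bar>2 powi j * y $ i - 2 powi j * x $ i\<bar> < 1"
        using pos by (simp add: abs_mult flip: right_diff_distrib)
      then show "\<bar>2 powi j * y $ i - of_int (p x $ i)\<bar> \<le> 2" using px[of x i] by linarith
    qed
    then have "eventually (\<lambda>y. ?f y = ?h y) (nhds x)"
      unfolding eventually_nhds_metric using pos by (intro exI[of _ "1 / 2 powi j"]) auto
    from isCont_cong[OF this] h show ?thesis by simp
  qed
  then have "?f \<in> bcontfun" using bd
    by (simp add: bcontfun_def continuous_on_eq_continuous_at)
  then have "apply_bcontfun (Bcontfun ?f) = ?f" by (rule Bcontfun_inverse)
  then show ?thesis using a unfolding V_def by blast
qed

end

theory Submission
  imports Defs
begin

text \<open>
  The inclusion of the closure in \<open>C\<^sub>u\<close> holds because \<open>\<Phi> = tensor_mother \<phi>\<close> is uniformly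
  continuous and, near any point, a series in \<open>V \<Phi> j\<close> has a number of terms that depends only on
  the support of \<open>\<Phi>\<close>; moreover uniform limits preserve uniform continuity.

  For density, \<open>f \<in> C\<^sub>u\<close> is approximated by its quasi-interpolant
  \<open>\<Sum>k. f (k / 2 ^ j) \<Phi> (2 ^ j x - k)\<close>. If the integer translates of \<open>\<Phi>\<close> sum to 1, then the error
  at \<open>x\<close> is \<open>\<Sum>k. (f x - f (k / 2 ^ j)) \<Phi> (2 ^ j x - k)\<close>, where boundedly many terms occur and
  each of them compares values of \<open>f\<close> at distance \<open>O(2 ^ -j)\<close>.

  So everything rests on \<open>\<Phi>\<close> generating a partition of unity. By the product structure it is
  enough to consider \<open>\<phi>\<close>. Iterating the refinement equation gives
  \<open>\<phi> x = \<Sum>k. \<phi> (k / 2 ^ j) \<phi> (2 ^ j x - k)\<close> for every \<open>j\<close>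
  (lemma \<open>iterated_refinement\<close>). At \<open>x = y / 2 ^ j\<close> this reads
  \<open>\<phi> (y / 2 ^ j) = \<Sum>k. \<phi> (k / 2 ^ j) \<phi> (y - k)\<close>, a sum over a finite set of \<open>k\<close> that does not
  depend on \<open>j\<close>. As \<open>j\<close> tends to infinity, continuity at 0 and \<open>\<phi> 0 = 1\<close> yield
  \<open>1 = \<Sum>k. \<phi> (y - k)\<close>.
\<close>

section \<open>Partition of unity\<close>

lemma mother_support:
  assumes "interpolating_mother_scaling \<phi>"
  obtains R where "\<And>x. \<phi> x \<noteq> 0 \<Longrightarrow> \<bar>x\<bar> \<le> R"
proof -
  have "bounded {x. \<phi> x \<noteq> 0}"
    using assms bounded_subset[OF compact_imp_bounded closure_subset]
    unfolding interpolating_mother_scaling_def by blast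
  then show thesis using that unfolding bounded_real by blast
qed

lemma mother_at_int:
  assumes "interpolating_mother_scaling \<phi>"
  shows "\<phi> (of_int k) = (if k = 0 then 1 else 0)"
  using assms unfolding interpolating_mother_scaling_def by blast

lemma mother_at_0:
  assumes "interpolating_mother_scaling \<phi>"
  shows "\<phi> 0 = 1"
  using mother_at_int[OF assms, of 0] by simp

lemma finite_int_near: "finite {k::int. \<bar>y - of_int k\<bar> \<le> R}" for y R :: real
proof (rule finite_subset)
  show "{k::int. \<bar>y - of_int k\<bar> \<le> R} \<subseteq> {\<lfloor>y - R\<rfloor>..\<lceil>y + R\<rceil>}"
  proof
    fix k :: int assume "k \<in> {k. \<bar>y - of_int k\<bar> \<le> R}"
    then have "y - R \<le> of_int k" "of_int k \<le> y + R" by auto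
    then show "k \<in> {\<lfloor>y - R\<rfloor>..\<lceil>y + R\<rceil>}" by (auto simp: floor_le_iff le_ceiling_iff)
  qed
qed simp

lemma infsum_eq_sum_support:
  fixes f :: "'a \<Rightarrow> 'b::{comm_monoid_add, t2_space}"
  assumes "finite A" "\<And>k. f k \<noteq> 0 \<Longrightarrow> k \<in> A"
  shows "infsum f UNIV = sum f A"
proof -
  have "infsum f UNIV = infsum f A"
    by (rule infsum_cong_neutral) (use assms(2) in auto)
  then show ?thesis using assms(1) by simp
qed

text \<open>
  The inductive step applies the refinement equation to each factor \<open>\<phi> (2 ^ j x - k)\<close> and collects
  the terms with \<open>\<phi> (2 ^ (j + 1) x - l)\<close>. Their coefficient
  \<open>\<Sum>k. \<phi> (k / 2 ^ j) \<phi> (l / 2 - k)\<close> is, by the induction hypothesis at the dyadic point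
  \<open>l / 2 ^ (j + 1)\<close>, the value of \<open>\<phi>\<close> there.
\<close>

lemma iterated_refinement:
  fixes \<phi> :: "real \<Rightarrow> 'k::real_normed_field"
  assumes \<phi>: "interpolating_mother_scaling \<phi>"
  shows "\<phi> x = (\<Sum>\<^sub>\<infinity>k\<in>UNIV. \<phi> (of_int k / 2 ^ j) * \<phi> (2 ^ j * x - of_int k))"
proof (induction j arbitrary: x)
  case 0
  have "(\<Sum>\<^sub>\<infinity>k\<in>UNIV. \<phi> (of_int k / 2 ^ 0) * \<phi> (2 ^ 0 * x - of_int k)) =
      (\<Sum>k\<in>{0}. \<phi> (of_int k / 2 ^ 0) * \<phi> (2 ^ 0 * x - of_int k))"
    by (intro infsum_eq_sum_support) (auto simp: mother_at_int[OF \<phi>] split: if_splits)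
  also have "\<dots> = \<phi> x"
    by (simp add: mother_at_0[OF \<phi>])
  finally show ?case by simp
next
  case (Suc j)
  obtain R where R: "\<And>x. \<phi> x \<noteq> 0 \<Longrightarrow> \<bar>x\<bar> \<le> R"
    using mother_support[OF \<phi>] by blast
  have refine: "\<phi> y = (\<Sum>\<^sub>\<infinity>k\<in>UNIV. \<phi> (of_int k / 2) * \<phi> (2 * y - of_int k))" for y
    using \<phi> unfolding interpolating_mother_scaling_def by blast
  define A where "A = {k::int. \<bar>0 - of_int k\<bar> \<le> 2 ^ j * R}"
  define B where "B = {l::int. \<bar>2 ^ Suc j * x - of_int l\<bar> \<le> R}"
  have fin: "finite A" "finite B" unfolding A_def B_def by (rule finite_int_near)+
  have A: "k \<in> A" if "\<phi> (of_int k / 2 ^ j) \<noteq> 0" for k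
    using R[OF that] by (simp add: A_def field_simps)
  have B: "l \<in> B" if "\<phi> (2 ^ Suc j * x - of_int l) \<noteq> 0" for l
    using R[OF that] by (simp add: B_def)
  have ind: "\<phi> y = (\<Sum>k\<in>A. \<phi> (of_int k / 2 ^ j) * \<phi> (2 ^ j * y - of_int k))" for y
    by (subst Suc.IH, rule infsum_eq_sum_support[OF fin(1)]) (use A in auto)
  have step: "\<phi> (2 ^ j * x - of_int k) =
      (\<Sum>l\<in>B. \<phi> (of_int l / 2 - of_int k) * \<phi> (2 ^ Suc j * x - of_int l))" for k :: int
  proof -
    have shift: "bij (\<lambda>l::int. l - 2 * k)"
      by (rule bij_betw_byWitness[where f' = "\<lambda>l. l + 2 * k"]) auto
    have "\<phi> (2 ^ j * x - of_int k) =
        (\<Sum>\<^sub>\<infinity>m\<in>UNIV. \<phi> (of_int m / 2) * \<phi> (2 * (2 ^ j * x - of_int k) - of_int m))"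
      by (rule refine)
    also have "\<dots> =
        (\<Sum>\<^sub>\<infinity>l\<in>UNIV. \<phi> (of_int (l - 2 * k) / 2) * \<phi> (2 * (2 ^ j * x - of_int k) - of_int (l - 2 * k)))"
      by (rule infsum_reindex_bij_betw[OF shift, symmetric])
    also have "\<dots> = (\<Sum>\<^sub>\<infinity>l\<in>UNIV. \<phi> (of_int l / 2 - of_int k) * \<phi> (2 ^ Suc j * x - of_int l))"
      by (simp add: diff_divide_distrib algebra_simps)
    also have "\<dots> = (\<Sum>l\<in>B. \<phi> (of_int l / 2 - of_int k) * \<phi> (2 ^ Suc j * x - of_int l))"
      by (rule infsum_eq_sum_support[OF fin(2)]) (use B in auto)
    finally show ?thesis .
  qed
  have coeff: "(\<Sum>k\<in>A. \<phi> (of_int k / 2 ^ j) * \<phi> (of_int l / 2 - of_int k)) = \<phi> (of_int l / 2 ^ Suc j)"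
    for l :: int
    using ind[of "of_int l / 2 ^ Suc j"] by simp
  have "\<phi> x = (\<Sum>k\<in>A. \<phi> (of_int k / 2 ^ j) *
      (\<Sum>l\<in>B. \<phi> (of_int l / 2 - of_int k) * \<phi> (2 ^ Suc j * x - of_int l)))"
    by (subst ind) (simp only: step)
  also have "\<dots> = (\<Sum>l\<in>B. (\<Sum>k\<in>A. \<phi> (of_int k / 2 ^ j) * \<phi> (of_int l / 2 - of_int k)) *
      \<phi> (2 ^ Suc j * x - of_int l))"
    unfolding sum_distrib_left sum_distrib_right by (subst sum.swap) (simp only: mult.assoc)
  also have "\<dots> = (\<Sum>l\<in>B. \<phi> (of_int l / 2 ^ Suc j) * \<phi> (2 ^ Suc j * x - of_int l))"
    by (simp only: coeff)
  also have "\<dots> = (\<Sum>\<^sub>\<infinity>l\<in>UNIV. \<phi> (of_int l / 2 ^ Suc j) * \<phi> (2 ^ Suc j * x - of_int l))"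
    by (rule infsum_eq_sum_support[symmetric, OF fin(2)]) (use B in auto)
  finally show ?case .
qed

text \<open>
  Both sides of the iterated refinement equation at \<open>y / 2 ^ j\<close> converge as \<open>j\<close> grows: the left one
  to \<open>\<phi> 0 = 1\<close>, the right one to the sum of the translates.
\<close>

lemma sum_translates_eq_1:
  fixes \<phi> :: "real \<Rightarrow> 'k::real_normed_field"
  assumes \<phi>: "interpolating_mother_scaling \<phi>"
    and fin: "finite B" and B: "\<And>k::int. \<phi> (y - of_int k) \<noteq> 0 \<Longrightarrow> k \<in> B"
  shows "(\<Sum>k\<in>B. \<phi> (y - of_int k)) = 1"
proof -
  have eq: "\<phi> (y / 2 ^ j) = (\<Sum>k\<in>B. \<phi> (of_int k / 2 ^ j) * \<phi> (y - of_int k))" for j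
    by (subst iterated_refinement[OF \<phi>, where j = j], subst infsum_eq_sum_support[OF fin])
      (use B in auto)
  have "continuous_on UNIV \<phi>"
    using \<phi> unfolding interpolating_mother_scaling_def by blast
  then have "isCont \<phi> 0" by (simp add: continuous_on_eq_continuous_at)
  have lim: "(\<lambda>j. \<phi> (z / 2 ^ j)) \<longlonglongrightarrow> 1" for z
  proof -
    have "(\<lambda>j. z / 2 ^ j) \<longlonglongrightarrow> 0"
      using tendsto_mult[OF tendsto_const LIMSEQ_power_zero[of "1/2::real"], of z]
      by (simp add: power_divide)
    then show ?thesis using isCont_tendsto_compose[OF \<open>isCont \<phi> 0\<close>] mother_at_0[OF \<phi>] by metis
  qed
  have "(\<lambda>j. \<phi> (y / 2 ^ j)) \<longlonglongrightarrow> (\<Sum>k\<in>B. 1 * \<phi> (y - of_int k))"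
    unfolding eq by (intro tendsto_intros lim)
  from LIMSEQ_unique[OF this lim] show ?thesis by simp
qed

text \<open>Expanding the product over the coordinates of one-dimensional sums gives the tensor sum.\<close>

lemma scaling_series_1:
  fixes \<phi> :: "real \<Rightarrow> 'k::real_normed_field" and x :: "real ^ 'n"
  assumes \<phi>: "interpolating_mother_scaling \<phi>"
  shows "scaling_series (tensor_mother \<phi>) j (\<lambda>_. 1) x = 1"
proof -
  obtain R where R: "\<And>x. \<phi> x \<noteq> 0 \<Longrightarrow> \<bar>x\<bar> \<le> R"
    using mother_support[OF \<phi>] by blast
  define y where "y = 2 powi j *\<^sub>R x"
  define B where "B i = {k::int. \<bar>y $ i - of_int k\<bar> \<le> R}" for i
  have fin: "finite (B i)" for i unfolding B_def by (rule finite_int_near)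
  have term_eq: "tensor_mother \<phi> (y - int_vec k) = (\<Prod>i\<in>UNIV. \<phi> (y $ i - of_int (k $ i)))" for k
    by (simp add: tensor_mother_def int_vec_def)
  have "scaling_series (tensor_mother \<phi>) j (\<lambda>_. 1) x =
      (\<Sum>\<^sub>\<infinity>k\<in>UNIV. \<Prod>i\<in>UNIV. \<phi> (y $ i - of_int (k $ i)))"
    unfolding scaling_series_def y_def[symmetric] term_eq by simp
  also have "\<dots> = (\<Sum>k\<in>vec_lambda ` PiE UNIV B. \<Prod>i\<in>UNIV. \<phi> (y $ i - of_int (k $ i)))"
  proof (rule infsum_eq_sum_support)
    show "finite (vec_lambda ` PiE UNIV B)" by (intro finite_imageI finite_PiE fin) simp
    fix k assume "(\<Prod>i\<in>UNIV. \<phi> (y $ i - of_int (k $ i))) \<noteq> 0"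
    then have "vec_nth k \<in> PiE UNIV B" by (auto simp: B_def R)
    then show "k \<in> vec_lambda ` PiE UNIV B" by (metis image_eqI vec_nth_inverse)
  qed
  also have "\<dots> = (\<Sum>g\<in>PiE UNIV B. \<Prod>i\<in>UNIV. \<phi> (y $ i - of_int (g i)))"
    by (subst sum.reindex) (auto simp: inj_on_def vec_lambda_inject)
  also have "\<dots> = (\<Prod>i\<in>UNIV. \<Sum>k\<in>B i. \<phi> (y $ i - of_int k))"
    by (rule prod_sum_PiE[symmetric]) (use fin in auto)
  also have "\<dots> = 1"
    by (intro prod.neutral ballI sum_translates_eq_1[OF \<phi> fin]) (auto simp: B_def R)
  finally show ?thesis .
qed

section \<open>Scaling series are uniformly continuous\<close>

lemma uniformly_continuous_compact_support:
  fixes \<Phi> :: "real ^ 'n \<Rightarrow> 'k::real_normed_vector"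
  assumes cont: "continuous_on UNIV \<Phi>" and R: "\<And>y i. \<Phi> y \<noteq> 0 \<Longrightarrow> \<bar>y $ i\<bar> \<le> R"
  shows "uniformly_continuous_on UNIV \<Phi>"
proof -
  let ?S = "cbox (\<chi> i. - (R + 1)) (\<chi> i. R + 1) :: (real ^ 'n) set"
  have S: "y \<in> ?S" if "\<Phi> z \<noteq> 0" "dist y z \<le> 1" for y z
    unfolding mem_box_cart
  proof
    fix i
    have "\<bar>y $ i - z $ i\<bar> \<le> 1"
      using component_le_norm_cart[of "y - z" i] that(2) by (simp add: dist_norm)
    then show "(\<chi> i. - (R + 1)) $ i \<le> y $ i \<and> y $ i \<le> (\<chi> i. R + 1) $ i"
      using R[OF that(1), of i] by simp linarith
  qed
  have uc: "uniformly_continuous_on ?S \<Phi>"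
    by (rule compact_uniformly_continuous[OF continuous_on_subset[OF cont] compact_cbox]) simp
  show ?thesis
    unfolding uniformly_continuous_on_def
  proof (intro allI impI)
    fix e :: real assume "e > 0"
    then obtain d where "d > 0"
      and d: "\<And>y z. y \<in> ?S \<Longrightarrow> z \<in> ?S \<Longrightarrow> dist z y < d \<Longrightarrow> dist (\<Phi> z) (\<Phi> y) < e"
      using uc unfolding uniformly_continuous_on_def by meson
    have "dist (\<Phi> z) (\<Phi> y) < e" if "dist z y < min d 1" for y z
    proof (cases "\<Phi> z = 0 \<and> \<Phi> y = 0")
      case True
      then show ?thesis using \<open>e > 0\<close> by simp
    next
      case False
      then have "y \<in> ?S \<and> z \<in> ?S"
        using S[of z y] S[of z z] S[of y z] S[of y y] that by (auto simp: dist_commute)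
      then show ?thesis using d that by simp
    qed
    then show "\<exists>d>0. \<forall>x\<in>UNIV. \<forall>x'\<in>UNIV. dist x' x < d \<longrightarrow> dist (\<Phi> x') (\<Phi> x) < e"
      using \<open>d > 0\<close> by (intro exI[of _ "min d 1"]) auto
  qed
qed

lemma near_floor:
  fixes x y :: "real ^ 'n"
  assumes "c > 0" "dist y x < 1 / c"
  shows "\<bar>c * y $ i - of_int \<lfloor>c * x $ i\<rfloor>\<bar> \<le> 2"
proof -
  have "\<bar>y $ i - x $ i\<bar> < 1 / c"
    using component_le_norm_cart[of "y - x" i] assms(2) by (simp add: dist_norm)
  then have "c * \<bar>y $ i - x $ i\<bar> < 1" using assms(1) by (simp add: field_simps)
  then have "\<bar>c * y $ i - c * x $ i\<bar> < 1"
    using assms(1) by (simp add: abs_mult flip: right_diff_distrib)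
  then show ?thesis by linarith
qed

text \<open>
  Points at distance less than \<open>1 / 2 powi j\<close> share one finite index set for the series, of a size
  that does not depend on their position. The oscillation of the series at a small scale \<open>\<delta>\<close> is
  therefore at most a constant times that of \<open>tensor_mother \<phi>\<close> at scale \<open>2 powi j * \<delta>\<close>.
\<close>

lemma V_subset_Cu:
  fixes \<phi> :: "real \<Rightarrow> 'k::real_normed_field"
  assumes \<phi>: "interpolating_mother_scaling \<phi>"
  shows "V (tensor_mother \<phi> :: real ^ 'n \<Rightarrow> 'k) j \<subseteq> C\<^sub>u"
proof
  fix f assume "f \<in> V (tensor_mother \<phi> :: real ^ 'n \<Rightarrow> 'k) j"
  let ?\<Phi> = "tensor_mother \<phi> :: real ^ 'n \<Rightarrow> 'k"
  obtain a where a: "bounded (range a)" and f: "apply_bcontfun f = scaling_series ?\<Phi> j a"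
    using \<open>f \<in> _\<close> unfolding V_def by blast
  obtain R where R: "\<And>(y :: real ^ 'n) i. ?\<Phi> y \<noteq> 0 \<Longrightarrow> \<bar>y $ i\<bar> \<le> R"
    using tensor_mother_support[OF \<phi>] by blast
  obtain A where "A > 0" and A: "\<And>k. norm (a k) \<le> A"
    using a unfolding bounded_pos by auto
  let ?M = "{m :: int ^ 'n. \<forall>i. \<bar>m $ i\<bar> \<le> \<lceil>R\<rceil> + 2}"
  define c :: real where "c = 2 powi j"
  have c: "c > 0" by (simp add: c_def)
  define p :: "real ^ 'n \<Rightarrow> int ^ 'n" where "p x = (\<chi> i. \<lfloor>c * x $ i\<rfloor>)" for x
  have loc: "scaling_series ?\<Phi> j a y = (\<Sum>m\<in>?M. a (p x + m) * ?\<Phi> (c *\<^sub>R y - int_vec (p x + m)))"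
    if "dist y x < 1 / c" for x y
    unfolding c_def
    by (rule scaling_series_local_sum[of ?\<Phi> R, OF R], assumption)
      (use near_floor[OF c that] in \<open>simp add: p_def c_def\<close>)
  have uc: "uniformly_continuous_on UNIV ?\<Phi>"
    using uniformly_continuous_compact_support[OF tensor_mother_continuous[OF \<phi>] R] .
  show "f \<in> C\<^sub>u"
    unfolding C\<^sub>u_def mem_Collect_eq f uniformly_continuous_on_def
  proof (intro allI impI)
    fix e :: real assume "e > 0"
    define C where "C = (of_nat (card ?M) + 1) * A"
    have "C > 0" using \<open>A > 0\<close> by (simp add: C_def add_nonneg_pos)
    then have "e / C > 0" using \<open>e > 0\<close> by simp
    then obtain d where "d > 0" and d: "\<And>y z. dist z y < d \<Longrightarrow> dist (?\<Phi> z) (?\<Phi> y) < e / C"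
      using uc unfolding uniformly_continuous_on_def by (meson UNIV_I)
    have "dist (scaling_series ?\<Phi> j a y) (scaling_series ?\<Phi> j a x) < e"
      if yx: "dist y x < min (1 / c) (d / c)" for x y
    proof -
      have close: "dist (c *\<^sub>R y - v) (c *\<^sub>R x - v) < d" for v
      proof -
        have "dist (c *\<^sub>R y - v) (c *\<^sub>R x - v) = c * dist y x"
          using c by (simp add: dist_norm flip: scaleR_diff_right)
        then show ?thesis using yx c by (simp add: field_simps)
      qed
      have "scaling_series ?\<Phi> j a y - scaling_series ?\<Phi> j a x =
          (\<Sum>m\<in>?M. a (p x + m) *
            (?\<Phi> (c *\<^sub>R y - int_vec (p x + m)) - ?\<Phi> (c *\<^sub>R x - int_vec (p x + m))))"
        using yx c by (simp add: loc[of y x] loc[of x x] sum_subtractf right_diff_distrib)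
      also have "norm \<dots> \<le> of_nat (card ?M) * (A * (e / C))"
        using less_imp_le[OF d[OF close]] \<open>A > 0\<close> unfolding dist_norm
        by (intro sum_norm_bound, unfold norm_mult) (intro mult_mono A, auto)
      also have "\<dots> = (of_nat (card ?M) * A) * (e / C)" by (simp only: mult_ac)
      also have "\<dots> < C * (e / C)"
        by (rule mult_strict_right_mono)
          (use \<open>A > 0\<close> \<open>e / C > 0\<close> in \<open>auto simp: C_def algebra_simps\<close>)
      finally show ?thesis using \<open>C > 0\<close> by (simp add: dist_norm)
    qed
    then show "\<exists>d>0. \<forall>x\<in>UNIV. \<forall>x'\<in>UNIV. dist x' x < d \<longrightarrow>
        dist (scaling_series ?\<Phi> j a x') (scaling_series ?\<Phi> j a x) < e"
      using \<open>d > 0\<close> c by (intro exI[of _ "min (1 / c) (d / c)"]) auto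
  qed
qed

lemma closed_Cu: "closed (C\<^sub>u :: ((real ^ 'n) \<Rightarrow>\<^sub>C 'k::real_normed_field) set)"
proof -
  have "f \<in> C\<^sub>u" if f: "f \<in> closure C\<^sub>u" for f :: "(real ^ 'n) \<Rightarrow>\<^sub>C 'k"
    unfolding C\<^sub>u_def mem_Collect_eq uniformly_continuous_on_def
  proof (intro allI impI)
    fix e :: real assume "e > 0"
    then have "e / 3 > 0" by simp
    then obtain g where "g \<in> C\<^sub>u" and g: "dist g f < e / 3"
      using f unfolding closure_approachable by blast
    then obtain d where "d > 0"
      and d: "\<And>x y. dist y x < d \<Longrightarrow> dist (apply_bcontfun g y) (apply_bcontfun g x) < e / 3"
      using \<open>e / 3 > 0\<close> unfolding C\<^sub>u_def uniformly_continuous_on_def mem_Collect_eq by (meson UNIV_I)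
    have gf: "dist (apply_bcontfun g x) (apply_bcontfun f x) < e / 3" for x
      using dist_bounded[of g x f] g by linarith
    have "dist (apply_bcontfun f y) (apply_bcontfun f x) < e" if "dist y x < d" for x y
      using gf[of x] gf[of y] d[OF that]
      by (metis dist_commute dist_triangle_third)
    then show "\<exists>d>0. \<forall>x\<in>UNIV. \<forall>x'\<in>UNIV. dist x' x < d \<longrightarrow>
        dist (apply_bcontfun f x') (apply_bcontfun f x) < e"
      using \<open>d > 0\<close> by blast
  qed
  then show ?thesis using closure_subset closure_eq by blast
qed

section \<open>Density\<close>

lemma bounded_range_bcontfun: "bounded (range (apply_bcontfun f))"
  using apply_bcontfun[of f] by (simp add: bcontfun_def)

text \<open>
  Near \<open>x\<close> the series only involves nodes \<open>k / 2 ^ j\<close> whose coordinates differ from those of \<open>x\<close> by at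
  most \<open>(\<lceil>R\<rceil> + 3) / 2 ^ j\<close>, where \<open>R\<close> bounds the support: \<open>\<lceil>R\<rceil> + 2\<close> is the size of the index box of
  \<open>scaling_series_local_sum\<close> and 1 accounts for rounding \<open>2 ^ j x\<close> down to its centre. The partition
  of unity turns \<open>f x\<close> into a series with the same translates, so that the two can be compared term
  by term.
\<close>

lemma Cu_subset_closure:
  fixes \<phi> :: "real \<Rightarrow> 'k::real_normed_field"
  assumes \<phi>: "interpolating_mother_scaling \<phi>"
  shows "C\<^sub>u \<subseteq> closure (\<Union>j::int. V (tensor_mother \<phi> :: real ^ 'n \<Rightarrow> 'k) j)"
proof
  fix f :: "(real ^ 'n) \<Rightarrow>\<^sub>C 'k" assume "f \<in> C\<^sub>u"
  let ?\<Phi> = "tensor_mother \<phi> :: real ^ 'n \<Rightarrow> 'k"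
  obtain R where R: "\<And>(y :: real ^ 'n) i. ?\<Phi> y \<noteq> 0 \<Longrightarrow> \<bar>y $ i\<bar> \<le> R"
    using tensor_mother_support[OF \<phi>] by blast
  obtain B where B: "\<And>y. norm (?\<Phi> y) \<le> B" "B \<ge> 0"
    using tensor_mother_bounded[OF \<phi>] by blast
  let ?M = "{m :: int ^ 'n. \<forall>i. \<bar>m $ i\<bar> \<le> \<lceil>R\<rceil> + 2}"
  define r :: real where "r = of_int (\<lceil>R\<rceil> + 2) + 1"
  show "f \<in> closure (\<Union>j::int. V ?\<Phi> j)"
    unfolding closure_approachable
  proof (intro allI impI)
    fix e :: real assume "e > 0"
    define C where "C = of_nat (card ?M) * B + 1"
    have "C > 0" using \<open>B \<ge> 0\<close> by (simp add: C_def add_nonneg_pos)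
    then have "e / 2 / C > 0" using \<open>e > 0\<close> by simp
    then obtain d where "d > 0"
      and d: "\<And>y z. dist z y < d \<Longrightarrow> dist (apply_bcontfun f z) (apply_bcontfun f y) < e / 2 / C"
      using \<open>f \<in> C\<^sub>u\<close> unfolding C\<^sub>u_def uniformly_continuous_on_def mem_Collect_eq by (meson UNIV_I)
    obtain N :: nat where N: "of_nat CARD('n) * r / d < 2 ^ N"
      using real_arch_pow[of 2] by auto
    define j where "j = int N"
    define c :: real where "c = 2 powi j"
    have c: "c > 0" by (simp add: c_def)
    have cN: "of_nat CARD('n) * (r / c) < d"
      proof -
      have "c = 2 ^ N" by (simp add: c_def j_def)
      then have "of_nat CARD('n) * r / d < c" using N by simp
      then show ?thesis using c \<open>d > 0\<close> by (simp add: pos_divide_less_eq mult.commute)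
    qed
    define a where "a k = apply_bcontfun f ((1 / c) *\<^sub>R int_vec k)" for k :: "int ^ 'n"
    have "bounded (range a)"
      by (rule bounded_subset[OF bounded_range_bcontfun[of f]]) (auto simp: a_def)
    then obtain g where "g \<in> V ?\<Phi> j" and g: "apply_bcontfun g = scaling_series ?\<Phi> j a"
      using scaling_series_in_V[OF \<phi>] by blast
    have "dist (apply_bcontfun g x) (apply_bcontfun f x) \<le> e / 2" for x
    proof -
      define p :: "int ^ 'n" where "p = (\<chi> i. \<lfloor>c * x $ i\<rfloor>)"
      have loc: "scaling_series ?\<Phi> j b x = (\<Sum>m\<in>?M. b (p + m) * ?\<Phi> (c *\<^sub>R x - int_vec (p + m)))" for b
        unfolding c_def
        by (rule scaling_series_local_sum[of ?\<Phi> R, OF R], assumption)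
          (use near_floor[OF c, of x x] c in \<open>simp add: p_def c_def\<close>)
      have near: "dist ((1 / c) *\<^sub>R int_vec (p + m)) x < d" if "m \<in> ?M" for m
      proof -
        let ?v = "(1 / c) *\<^sub>R int_vec (p + m) - x"
        have "\<bar>?v $ i\<bar> \<le> r / c" for i
        proof -
          have "\<bar>m $ i\<bar> \<le> \<lceil>R\<rceil> + 2" using that by blast
          then have "\<bar>real_of_int (m $ i)\<bar> \<le> of_int (\<lceil>R\<rceil> + 2)"
            by (metis of_int_abs of_int_le_iff)
          moreover have "\<bar>of_int (p $ i) - c * x $ i\<bar> \<le> 1"
            unfolding p_def by simp linarith
          ultimately have "\<bar>of_int (p $ i + m $ i) - c * x $ i\<bar> \<le> r"
            unfolding r_def by simp
          moreover have "?v $ i = (of_int (p $ i + m $ i) - c * x $ i) / c"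
            using c by (simp add: int_vec_def field_simps)
          ultimately show ?thesis using c by (simp add: abs_divide divide_right_mono)
        qed
        then have "(\<Sum>i\<in>UNIV. \<bar>?v $ i\<bar>) \<le> of_nat CARD('n) * (r / c)"
          by (intro sum_bounded_above) simp
        then have "norm ?v \<le> of_nat CARD('n) * (r / c)"
          using norm_le_l1_cart[of ?v] by linarith
        then show ?thesis using cN by (simp add: dist_norm)
      qed
      have "apply_bcontfun f x = apply_bcontfun f x * scaling_series ?\<Phi> j (\<lambda>_. 1) x"
        by (simp add: scaling_series_1[OF \<phi>])
      also have "\<dots> = (\<Sum>m\<in>?M. apply_bcontfun f x * ?\<Phi> (c *\<^sub>R x - int_vec (p + m)))"
        by (simp add: loc sum_distrib_left)
      finally have "apply_bcontfun g x - apply_bcontfun f x =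
          (\<Sum>m\<in>?M. (a (p + m) - apply_bcontfun f x) * ?\<Phi> (c *\<^sub>R x - int_vec (p + m)))"
        by (simp add: g loc[of a] sum_subtractf left_diff_distrib)
      also have "norm \<dots> \<le> of_nat (card ?M) * (e / 2 / C * B)"
      proof (rule sum_norm_bound)
        fix m assume "m \<in> ?M"
        then have "norm (a (p + m) - apply_bcontfun f x) \<le> e / 2 / C"
          using d[OF near] by (simp add: a_def dist_norm less_imp_le)
        then show "norm ((a (p + m) - apply_bcontfun f x) * ?\<Phi> (c *\<^sub>R x - int_vec (p + m)))
            \<le> e / 2 / C * B"
          unfolding norm_mult using \<open>e / 2 / C > 0\<close> by (intro mult_mono B) auto
      qed
      also have "\<dots> = (of_nat (card ?M) * B) * (e / 2 / C)" by (simp only: mult_ac)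
      also have "\<dots> \<le> C * (e / 2 / C)"
        by (intro mult_right_mono less_imp_le[OF \<open>e / 2 / C > 0\<close>]) (simp add: C_def)
      finally show ?thesis using \<open>C > 0\<close> by (simp add: dist_norm)
    qed
    then have "dist g f \<le> e / 2" by (rule dist_bound)
    then show "\<exists>g\<in>\<Union>j. V ?\<Phi> j. dist g f < e"
      using \<open>g \<in> V ?\<Phi> j\<close> \<open>e > 0\<close> by (intro bexI[of _ g]) auto
  qed
qed

lemma closure_Union_V:
  fixes \<phi> :: "real \<Rightarrow> 'k::real_normed_field"
  assumes "interpolating_mother_scaling \<phi>"
  shows "closure (\<Union>j::int. V (tensor_mother \<phi> :: real ^ 'n \<Rightarrow> 'k) j) = C\<^sub>u"
proof (rule subset_antisym)
  show "closure (\<Union>j::int. V (tensor_mother \<phi> :: real ^ 'n \<Rightarrow> 'k) j) \<subseteq> C\<^sub>u"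
    using V_subset_Cu[OF assms] by (intro closure_minimal closed_Cu) blast
qed (rule Cu_subset_closure[OF assms])

theorem theorem6p20:
  fixes \<phi> :: "real \<Rightarrow> real" and \<psi> :: "real \<Rightarrow> complex"
  shows "(interpolating_mother_scaling \<phi> \<longrightarrow>
            closure (\<Union>j::int. V (tensor_mother \<phi> :: real ^ 'n \<Rightarrow> real) j) = C\<^sub>u) \<and>
         (interpolating_mother_scaling \<psi> \<longrightarrow>
            closure (\<Union>j::int. V (tensor_mother \<psi> :: real ^ 'n \<Rightarrow> complex) j) = C\<^sub>u)"
  by (intro conjI impI closure_Union_V)

end
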